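(* There exist a compact interval $I$ and a continuous map $g\colon I\to I$ which is chaotic in the sense of Li-Yorke but not chaotic in the sense of Wiggins.
   Context: Let $X$ be a metric space with distance $d$ and $T\colon X\to X$ continuous. $T$ is transitive if for all nonempty open subsets $U,V$ of $X$ there is an integer $n\ge 0$ with $T^{-n}(U)\cap V\neq\emptyset$. $T$ is sensitive if there is $\delta>0$ such that for all $x\in X$ and all neighbourhoods $U$ of $x$ there exist $y\in U$ and $n\ge 0$ with $d(T^n(x),T^n(y))\ge\delta$. A subset $Y\subset X$ is invariant if $T(Y)\subset Y$. $T$ is chaotic in the sense of Wiggins if there exists a nonempty closed invariant subset $Y\subset X$ such that the restriction $T|_Y\colon Y\to Y$ is transitive and sensitive. $T$ is chaotic in the sense of Li-Yorke if there exists an uncountable set $S\subset X$ such that for all $x,y\in S$ with $x\ne y$ one has $\limsup_{n\to+\infty}d(T^n(x),T^n(y))>0$ and $\liminf_{n\to+\infty}d(T^n(x),T^n(y))=0$. *)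

theory Defs
  imports "HOL-Analysis.Analysis"
begin

text \<open>
  The metric space is a subset \<open>X\<close> of a type of class \<^class>\<open>metric_space\<close>, with the subspace
  topology. A self-map of \<open>X\<close> is a total function \<open>T\<close> mapping \<open>X\<close> into \<open>X\<close>; its values
  outside \<open>X\<close> are irrelevant, so the restriction of \<open>T\<close> to an invariant subset \<open>Y\<close> is
  expressed by replacing \<open>X\<close> by \<open>Y\<close>.
\<close>

definition transitive_map_on :: "'a::metric_space set \<Rightarrow> ('a \<Rightarrow> 'a) \<Rightarrow> bool" where
  "transitive_map_on X T \<longleftrightarrow>
     (\<forall>U V. openin (top_of_set X) U \<and> U \<noteq> {} \<and> openin (top_of_set X) V \<and> V \<noteq> {} \<longrightarrow>
        (\<exists>n::nat. ((T ^^ n) -` U \<inter> X) \<inter> V \<noteq> {}))"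

definition neighbourhood_in :: "'a::metric_space set \<Rightarrow> 'a \<Rightarrow> 'a set \<Rightarrow> bool" where
  "neighbourhood_in X x U \<longleftrightarrow> U \<subseteq> X \<and> (\<exists>W. openin (top_of_set X) W \<and> x \<in> W \<and> W \<subseteq> U)"

definition sensitive_map_on :: "'a::metric_space set \<Rightarrow> ('a \<Rightarrow> 'a) \<Rightarrow> bool" where
  "sensitive_map_on X T \<longleftrightarrow>
     (\<exists>\<delta>>0. \<forall>x\<in>X. \<forall>U. neighbourhood_in X x U \<longrightarrow>
        (\<exists>y\<in>U. \<exists>n::nat. dist ((T ^^ n) x) ((T ^^ n) y) \<ge> \<delta>))"

definition wiggins_chaotic_on :: "'a::metric_space set \<Rightarrow> ('a \<Rightarrow> 'a) \<Rightarrow> bool" where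
  "wiggins_chaotic_on X T \<longleftrightarrow>
     (\<exists>Y. Y \<noteq> {} \<and> closedin (top_of_set X) Y \<and> T ` Y \<subseteq> Y \<and>
        transitive_map_on Y T \<and> sensitive_map_on Y T)"

text \<open>
  The upper and lower limits are taken in \<^typ>\<open>ereal\<close>, since \<^term>\<open>limsup\<close> and \<^term>\<open>liminf\<close>
  need a complete lattice and the distances may be unbounded.
\<close>

definition li_yorke_chaotic_on :: "'a::metric_space set \<Rightarrow> ('a \<Rightarrow> 'a) \<Rightarrow> bool" where
  "li_yorke_chaotic_on X T \<longleftrightarrow>
     (\<exists>S\<subseteq>X. uncountable S \<and>
        (\<forall>x\<in>S. \<forall>y\<in>S. x \<noteq> y \<longrightarrow>
           limsup (\<lambda>n. ereal (dist ((T ^^ n) x) ((T ^^ n) y))) > 0 \<and>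
           liminf (\<lambda>n. ereal (dist ((T ^^ n) x) ((T ^^ n) y))) = 0))"

end

theory Submission
  imports Defs
begin

text \<open>
  Start from an interval map of type \<open>2\<^sup>\<infinity>\<close> with a plateau \<open>[1, 2]\<close> that is the intersection of
  intervals \<open>J\<^sub>n\<close> with \<open>g\<close>-period \<open>2\<^sup>n\<close>, arranged so that the solenoid (the intersection of the
  cycles of the \<open>J\<^sub>n\<close>) approaches the plateau only from the left. Transient orbits may pass at time
  \<open>2\<^sup>n - 1\<close> through \<open>J\<^sub>n\<close> on either side of the plateau, independently for each \<open>n\<close>, and one step
  later they all lie in the tiny interval \<open>g J\<^sub>n\<close>; this yields a scrambled set indexed by the
  subsets of \<open>\<nat>\<close>. A transitive sensitive subsystem \<open>Y\<close>, on the other hand, has no isolated points,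
  so it enters the interior of every \<open>J\<^sub>n\<close> and lies in the solenoid. Hence \<open>Y \<inter> J\<^sub>n\<close> is to the left
  of the plateau, up to the plateau itself, which \<open>Y\<close> can meet only in the point 1. So \<open>Y \<inter> J\<^sub>n\<close> has
  small diameter, and so have all its images, because on \<open>g J\<^sub>n\<close> the map \<open>g ^ (2\<^sup>n - 1)\<close> expands more
  than its lower iterates.
\<close>

text \<open>
  \<open>J\<^sub>n = [lft n, rgt n]\<close> has length \<open>len n\<close>, and \<open>g J\<^sub>n \<subseteq> [0, eps n]\<close>. The recursion for \<open>eps\<close> makes
  the affine map of \<open>[0, eps n]\<close> onto \<open>J\<^sub>n\<close> send \<open>eps (Suc n)\<close> to \<open>mid n\<close>. This affine map will be
  \<open>g ^ (2\<^sup>n - 1)\<close>, so \<open>g\<close> is obtained by pulling back the desired return map \<open>ret n\<close> of \<open>J\<^sub>n\<close>, which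
  takes \<open>[lft n, mid n]\<close> onto \<open>J\<^sub>n\<^sub>+\<^sub>1\<close> and is steeply decreasing on \<open>[mid n, lft (Suc n)]\<close>. The value
  \<open>low n\<close> at \<open>lft (Suc n)\<close> is forced by continuity with the next level.
\<close>

definition rad :: "nat \<Rightarrow> real" where "rad n = (1/3) ^ n"
definition len :: "nat \<Rightarrow> real" where "len n = 1 + 2 * rad n"
definition lft :: "nat \<Rightarrow> real" where "lft n = 1 - rad n"
definition rgt :: "nat \<Rightarrow> real" where "rgt n = 2 + rad n"
definition mid :: "nat \<Rightarrow> real" where "mid n = 1 - 2 * rad n / 3"
definition low :: "nat \<Rightarrow> real" where "low n = lft n + 2 * (rad n)\<^sup>2 / (27 * len (Suc n))"
definition steep :: "nat \<Rightarrow> real" where "steep n = 3 * (rgt (Suc n) - low n) / rad n"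

primrec eps :: "nat \<Rightarrow> real" where
  "eps 0 = 3"
| "eps (Suc n) = eps n * rad n / (3 * len n)"

definition ret :: "nat \<Rightarrow> real \<Rightarrow> real" where
  "ret n x = (if x \<le> mid n then lft (Suc n) + 3 * len (Suc n) / rad n * (x - lft n)
              else rgt (Suc n) - steep n * (x - mid n))"

definition piece :: "nat \<Rightarrow> real \<Rightarrow> real" where
  "piece n x = eps n / len n * (ret n x - lft n)"

definition left_half :: "real \<Rightarrow> real" where
  "left_half x = (if x \<ge> 1 then 0 else piece (LEAST n. x \<le> lft (Suc n)) x)"

text \<open>The fold about 3/2 makes the graph symmetric and sends \<open>[1, 2]\<close> into the
  plateau; clamping at 0 keeps \<open>gmap\<close> continuous on the whole line.\<close>

definition gmap :: "real \<Rightarrow> real" where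
  "gmap x = left_half (max 0 (min x (3 - x)))"

section \<open>Estimates for the constants of the construction\<close>

lemma rad_pos: "rad n > 0" and rad_Suc: "rad (Suc n) = rad n / 3" and rad_le_1: "rad n \<le> 1"
  by (auto simp: rad_def power_le_one)

lemma rad_0: "rad 0 = 1"
  by (simp add: rad_def)

lemma rad_tendsto: "rad \<longlonglongrightarrow> 0"
  unfolding rad_def by (intro LIMSEQ_power_zero) auto

lemma rad_antimono: "m \<le> n \<Longrightarrow> rad n \<le> rad m"
  unfolding rad_def by (intro power_decreasing) auto

lemma len_pos: "len n > 0"
  using rad_pos[of n] by (simp add: len_def)

lemma eps_pos: "eps n > 0"
  by (induction n) (auto simp: rad_pos len_pos)

lemma eps_Suc_le: "eps (Suc n) \<le> eps n / 3"
proof -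
  have "rad n / len n \<le> 1"
    using rad_pos[of n] by (simp add: len_def)
  then have "eps n / 3 * (rad n / len n) \<le> eps n / 3 * 1"
    using eps_pos[of n] by (intro mult_left_mono) auto
  then show ?thesis by (simp add: field_simps)
qed

lemma eps_le: "eps n \<le> 3 * rad n"
proof (induction n)
  case (Suc n)
  then show ?case using eps_Suc_le[of n] rad_Suc[of n] by linarith
qed (simp add: rad_0)

lemma eps_antimono: "m \<le> n \<Longrightarrow> eps n \<le> eps m"
proof (rule lift_Suc_antimono_le)
  show "eps (Suc n) \<le> eps n" for n
    using eps_Suc_le[of n] eps_pos[of n] by linarith
qed

lemma order_facts:
  "0 \<le> lft n" "lft n < mid n" "mid n < lft (Suc n)" "lft n < 1" "2 < rgt n"
  "rgt (Suc n) < rgt n" "rgt n \<le> 3" "rgt n = 3 - lft n" "rgt n - lft n = len n"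
  using rad_pos[of n] rad_le_1[of n] by (auto simp: lft_def mid_def rgt_def len_def rad_Suc)

lemma lft_mono: "m \<le> n \<Longrightarrow> lft m \<le> lft n" and rgt_antimono: "m \<le> n \<Longrightarrow> rgt n \<le> rgt m"
  using rad_antimono[of m n] by (auto simp: lft_def rgt_def)

lemma low_bounds: "lft n < low n" "low n < mid n"
proof -
  show "lft n < low n"
    using rad_pos[of n] len_pos[of "Suc n"] by (simp add: low_def)
  have "(rad n)\<^sup>2 \<le> rad n * 1"
    unfolding power2_eq_square using rad_pos[of n] rad_le_1[of n] by (intro mult_left_mono) auto
  moreover have "len (Suc n) \<ge> 1" using rad_pos[of "Suc n"] by (simp add: len_def)
  ultimately have "2 * (rad n)\<^sup>2 / (27 * len (Suc n)) \<le> 2 * rad n / 27"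
    using rad_pos[of n] by (intro frac_le) auto
  then show "low n < mid n"
    using rad_pos[of n] by (simp add: low_def lft_def mid_def)
qed

text \<open>This expansion on the gap \<open>[mid n, lft (Suc n)]\<close> is what later forces
  uniqueness of the exceptional point there.\<close>

lemma steep_ge: "steep n \<ge> 3"
proof -
  have "rgt (Suc n) - low n \<ge> rad n"
    using low_bounds[of n] order_facts[of n] order_facts[of "Suc n"] rad_le_1[of n] by linarith
  then show ?thesis using rad_pos[of n] by (simp add: steep_def field_simps)
qed

section \<open>The model return maps\<close>

lemma ret_lft: "ret n (lft n) = lft (Suc n)"
  using order_facts[of n] by (simp add: ret_def)

lemma ret_mid: "ret n (mid n) = rgt (Suc n)"
  using rad_pos[of n] by (simp add: ret_def mid_def lft_def rgt_def len_def rad_Suc field_simps)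

lemma ret_lft_Suc: "ret n (lft (Suc n)) = low n"
  using rad_pos[of n]
  by (simp add: ret_def mid_def lft_def steep_def rad_Suc field_simps)

lemma ret_left: "x \<le> mid n \<Longrightarrow> ret n x = lft (Suc n) + 3 * len (Suc n) / rad n * (x - lft n)"
  by (simp add: ret_def)

lemma ret_gap: "mid n \<le> x \<Longrightarrow> ret n x = rgt (Suc n) - steep n * (x - mid n)"
  using ret_mid[of n] by (cases "x = mid n") (auto simp: ret_def)

lemma ret_bounds_left:
  assumes "lft n \<le> x" "x \<le> mid n"
  shows "lft (Suc n) \<le> ret n x" "ret n x \<le> rgt (Suc n)"
    "lft n < x \<Longrightarrow> lft (Suc n) < ret n x" "x < mid n \<Longrightarrow> ret n x < rgt (Suc n)"
proof -
  have c: "3 * len (Suc n) / rad n > 0" using len_pos rad_pos by simp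
  have e: "rgt (Suc n) = lft (Suc n) + 3 * len (Suc n) / rad n * (mid n - lft n)"
    using ret_mid[of n] by (simp add: ret_left)
  show "lft (Suc n) \<le> ret n x" "lft n < x \<Longrightarrow> lft (Suc n) < ret n x"
    using mult_nonneg_nonneg[OF less_imp_le[OF c], of "x - lft n"] mult_pos_pos[OF c, of "x - lft n"]
      assms unfolding ret_left[OF assms(2)] by linarith+
  show "ret n x \<le> rgt (Suc n)" unfolding e ret_left[OF assms(2)]
    using c assms by (intro add_mono mult_left_mono) auto
  show "ret n x < rgt (Suc n)" if "x < mid n" unfolding e ret_left[OF assms(2)]
    using c that by (intro add_strict_left_mono mult_strict_left_mono) auto
qed

lemma ret_bounds_gap:
  assumes "mid n \<le> x" "x \<le> lft (Suc n)"
  shows "low n \<le> ret n x" "ret n x \<le> rgt (Suc n)"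
proof -
  have e: "low n = rgt (Suc n) - steep n * (lft (Suc n) - mid n)"
    using ret_lft_Suc[of n] order_facts(3)[of n] by (simp add: ret_gap)
  show "low n \<le> ret n x" unfolding e ret_gap[OF assms(1)]
    using steep_ge[of n] assms by (intro diff_left_mono mult_left_mono) auto
  show "ret n x \<le> rgt (Suc n)" unfolding ret_gap[OF assms(1)]
    using steep_ge[of n] assms by simp
qed

lemma ret_bounds:
  assumes "lft n \<le> x" "x \<le> lft (Suc n)"
  shows "lft n \<le> ret n x" "ret n x \<le> rgt (Suc n)"
proof -
  have "x \<le> mid n \<or> mid n \<le> x" by linarith
  then show "lft n \<le> ret n x" "ret n x \<le> rgt (Suc n)"
    using ret_bounds_left(1,2)[of n x] ret_bounds_gap[of n x] assms low_bounds(1)[of n]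
      order_facts(2,3)[of n] by linarith+
qed

section \<open>Gluing the pieces to a continuous map\<close>

lemma continuous_on_piece: "continuous_on A (piece n)"
proof -
  have "continuous_on UNIV (ret n)"
  proof -
    have "continuous_on ({..mid n} \<union> {mid n..}) (ret n)"
    proof (rule continuous_on_closed_Un)
      show "continuous_on {..mid n} (ret n)"
        by (rule continuous_on_eq[of _ "\<lambda>x. lft (Suc n) + 3 * len (Suc n) / rad n * (x - lft n)"])
           (use rad_pos[of n] in \<open>auto intro!: continuous_intros simp: ret_left\<close>)
      show "continuous_on {mid n..} (ret n)"
        by (rule continuous_on_eq[of _ "\<lambda>x. rgt (Suc n) - steep n * (x - mid n)"])
           (auto intro!: continuous_intros simp: ret_gap)
    qed auto
    moreover have "{..mid n} \<union> {mid n..} = UNIV" by auto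
    ultimately show ?thesis by simp
  qed
  then show ?thesis
    unfolding piece_def
    by (intro continuous_intros continuous_on_subset[of UNIV "ret n" A]) auto
qed

text \<open>The formula for \<open>low n\<close> is the solution of this equation, where
  \<open>lft (Suc (Suc n)) - lft (Suc n) = 2 * rad n / 9\<close>.\<close>

lemma piece_match: "piece n (lft (Suc n)) = piece (Suc n) (lft (Suc n))"
proof -
  have "piece n (lft (Suc n)) = eps n / len n * (2 * (rad n)\<^sup>2 / (27 * len (Suc n)))"
    by (simp add: piece_def ret_lft_Suc low_def)
  moreover have "piece (Suc n) (lft (Suc n)) = eps (Suc n) / len (Suc n) * (2 * rad n / 9)"
    by (simp add: piece_def ret_lft) (simp add: lft_def rad_Suc)
  ultimately show ?thesis by (simp add: field_simps power2_eq_square)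
qed

lemma left_half_eq:
  assumes "lft n \<le> x" "x \<le> lft (Suc n)"
  shows "left_half x = piece n x"
proof -
  have x1: "x < 1" using assms order_facts[of "Suc n"] by simp
  show ?thesis
  \<comment> \<open>At a common endpoint \<open>LEAST\<close> selects the lower level, so the two
    adjacent pieces have to agree there.\<close>
  proof (cases "x = lft n \<and> n > 0")
    case True
    then obtain m where m: "n = Suc m" using gr0_implies_Suc by blast
    have "(LEAST k. x \<le> lft (Suc k)) = m"
    proof (rule Least_equality)
      show "x \<le> lft (Suc m)" using True m by simp
      show "m \<le> k" if "x \<le> lft (Suc k)" for k
      proof (rule ccontr)
        assume "\<not> m \<le> k"
        then have "lft (Suc k) \<le> lft m" by (intro lft_mono) simp
        then show False using that True m order_facts[of m] by simp
      qed
    qed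
    then show ?thesis using True m piece_match[of m] x1 by (simp add: left_half_def)
  next
    case False
    have "(LEAST k. x \<le> lft (Suc k)) = n"
    proof (rule Least_equality)
      show "n \<le> k" if "x \<le> lft (Suc k)" for k
      proof (rule ccontr)
        assume *: "\<not> n \<le> k"
        then have "lft (Suc k) \<le> lft n" by (intro lft_mono) simp
        then show False using that False assms * by auto
      qed
    qed (use assms in auto)
    then show ?thesis using x1 by (simp add: left_half_def)
  qed
qed

lemma ex_level:
  assumes "lft n \<le> x" "x < 1"
  obtains k where "n \<le> k" "lft k \<le> x" "x \<le> lft (Suc k)"
proof -
  obtain N where N: "rad N < 1 - x"
    using order_tendstoD(2)[OF rad_tendsto, of "1 - x"] assms
    by (auto simp: eventually_sequentially)
  define P where "P = (\<lambda>k. x \<le> lft (Suc k))"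
  have ex: "P N"
    using N rad_antimono[of N "Suc N"] by (auto simp: P_def lft_def)
  define k where "k = (LEAST k. n \<le> k \<and> P k)"
  have "n \<le> max n N \<and> P (max n N)"
    using ex lft_mono[of "Suc N" "Suc (max n N)"] by (auto simp: P_def)
  then have k: "n \<le> k" "P k" unfolding k_def by (metis (mono_tags, lifting) LeastI)+
  have "lft k \<le> x"
  proof (cases "k = n")
    case False
    then obtain j where j: "k = Suc j" "n \<le> j" using k(1) by (cases k) auto
    then have "\<not> P j" using not_less_Least[of j "\<lambda>k. n \<le> k \<and> P k"] k_def by auto
    then show ?thesis using j by (simp add: P_def)
  qed (use assms in auto)
  with k that show ?thesis by (auto simp: P_def)
qed

lemma left_half_bounds:
  assumes "lft n \<le> x"
  shows "0 \<le> left_half x" "left_half x \<le> eps n"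
proof -
  have "0 \<le> left_half x \<and> left_half x \<le> eps n"
  proof (cases "x \<ge> 1")
    case True
    then show ?thesis using eps_pos[of n] by (simp add: left_half_def)
  next
    case False
    then obtain k where k: "n \<le> k" "lft k \<le> x" "x \<le> lft (Suc k)"
      using assms ex_level by (metis not_le)
    have "0 \<le> ret k x - lft k" "ret k x - lft k \<le> len k"
      using ret_bounds[OF k(2,3)] order_facts[of k] by auto
    then have "0 \<le> piece k x" "eps k / len k * (ret k x - lft k) \<le> eps k / len k * len k"
      using eps_pos[of k] len_pos[of k] unfolding piece_def
      by (simp, intro mult_left_mono) auto
    then have "0 \<le> piece k x" "piece k x \<le> eps k"
      using len_pos[of k] by (simp_all add: piece_def)
    then show ?thesis using left_half_eq[OF k(2,3)] eps_antimono[OF k(1)] by simp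
  qed
  then show "0 \<le> left_half x" "left_half x \<le> eps n" by auto
qed

lemma eps_tendsto: "eps \<longlonglongrightarrow> 0"
proof (rule tendsto_sandwich[of "\<lambda>_. 0" eps _ "\<lambda>n. 3 * rad n"])
  show "(\<lambda>n. 3 * rad n) \<longlonglongrightarrow> 0" using tendsto_mult_right_zero[OF rad_tendsto] by simp
  show "eventually (\<lambda>n. 0 \<le> eps n) sequentially"
    by (rule always_eventually) (use eps_pos in \<open>auto intro: less_imp_le\<close>)
  show "eventually (\<lambda>n. eps n \<le> 3 * rad n) sequentially"
    using eps_le by (rule always_eventually[OF allI])
qed simp

text \<open>Below 1 only finitely many pieces are glued at a time. From 1 on the value is 0, and to
  the right of \<open>lft N\<close> all values lie in \<open>[0, eps N]\<close> with
  \<open>eps\<close> tending to 0.\<close>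

lemma continuous_on_left_half: "continuous_on {0..} left_half"
proof -
  have fin: "continuous_on {0..lft n} left_half" for n
  proof (induction n)
    case 0
    have "{0..lft 0} = {0}" by (auto simp: lft_def rad_0)
    then show ?case by simp
  next
    case (Suc n)
    have "continuous_on {lft n..lft (Suc n)} left_half"
      using continuous_on_piece by (rule continuous_on_eq) (auto simp: left_half_eq[of n])
    then have "continuous_on ({0..lft n} \<union> {lft n..lft (Suc n)}) left_half"
      using Suc by (intro continuous_on_closed_Un) auto
    moreover have "{0..lft n} \<union> {lft n..lft (Suc n)} = {0..lft (Suc n)}"
      using order_facts[of n] by auto
    ultimately show ?case by simp
  qed
  show ?thesis
    unfolding continuous_on_eq_continuous_within
  proof
    fix x :: real assume x: "x \<in> {0..}"
    show "continuous (at x within {0..}) left_half"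
    proof (cases "x < 1")
      case True
      then obtain N where "rad N < 1 - x"
        using order_tendstoD(2)[OF rad_tendsto, of "1 - x"] by (auto simp: eventually_sequentially)
      then have N: "x < lft N" by (simp add: lft_def)
      have "continuous (at x within {0..lft N}) left_half"
        using fin[of N] x N by (simp add: continuous_on_eq_continuous_within)
      moreover have "at x within {0..lft N} = at x within {0..}"
        by (rule at_within_nhd[of x "{..<lft N}"]) (use x N in auto)
      ultimately show ?thesis by (simp add: continuous_within)
    next
      case False
      then have fx: "left_half x = 0" by (simp add: left_half_def)
      show ?thesis unfolding continuous_within fx
      proof (rule order_tendstoI)
        fix a :: real assume a: "a < 0"
        show "eventually (\<lambda>y. a < left_half y) (at x within {0..})"
          unfolding eventually_at_topological
          using a left_half_bounds(1)[of 0] by (intro exI[of _ UNIV]) (auto simp: lft_def rad_0 intro: less_le_trans)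
      next
        fix a :: real assume a: "0 < a"
        then obtain N where N: "eps N < a"
          using order_tendstoD(2)[OF eps_tendsto, of a] by (auto simp: eventually_sequentially)
        have "left_half y < a" if "y > lft N" for y
          using left_half_bounds(2)[of N y] N that by simp
        moreover have "x > lft N" using False order_facts[of N] by simp
        ultimately show "eventually (\<lambda>y. left_half y < a) (at x within {0..})"
          unfolding eventually_at_topological by (intro exI[of _ "{lft N<..}"]) auto
      qed
    qed
  qed
qed

lemma continuous_on_gmap: "continuous_on A gmap"
proof -
  have "continuous_on A (left_half \<circ> (\<lambda>x. max 0 (min x (3 - x))))"
    by (intro continuous_on_compose continuous_intros continuous_on_subset[OF continuous_on_left_half]) auto
  then show ?thesis by (simp add: gmap_def[abs_def] o_def)
qed

lemma continuous_on_gmap_pow: "continuous_on A (gmap ^^ n)"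
proof (induction n)
  case (Suc n)
  then show ?case
    using continuous_on_compose[OF Suc continuous_on_gmap] by (simp add: o_def)
qed (simp add: id_def)

section \<open>Return maps of the nested intervals\<close>

lemma gmap_sym: "gmap (3 - x) = gmap x"
  by (simp add: gmap_def min.commute)

definition nest :: "nat \<Rightarrow> real set" where "nest n = {lft n..rgt n}"

lemma nest_antimono: "m \<le> n \<Longrightarrow> nest n \<subseteq> nest m"
  using lft_mono[of m n] rgt_antimono[of m n] by (auto simp: nest_def)

lemma gmap_nest: "x \<in> nest n \<Longrightarrow> gmap x \<in> {0..eps n}"
proof -
  assume "x \<in> nest n"
  then have "lft n \<le> max 0 (min x (3 - x))"
    by (auto simp: nest_def lft_def rgt_def)
  then show ?thesis using left_half_bounds by (simp add: gmap_def)
qed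

lemma gmap_piece: "lft n \<le> x \<Longrightarrow> x \<le> lft (Suc n) \<Longrightarrow> gmap x = piece n x"
  using left_half_eq[of n x] order_facts[of n] order_facts[of "Suc n"]
  by (simp add: gmap_def max_def min_def)

text \<open>The time \<open>2 ^ Suc n - 1\<close> consists of two runs of length
  \<open>2 ^ n - 1\<close> with a single step between them.\<close>

lemma pow_split: "(gmap ^^ (2 ^ Suc n - 1)) u = (gmap ^^ (2 ^ n - 1)) (gmap ((gmap ^^ (2 ^ n - 1)) u))"
proof -
  have e: "(2::nat) ^ Suc n - 1 = (2 ^ n - 1) + Suc (2 ^ n - 1)"
    using one_le_power[of "2::nat" n] by (simp add: mult_2)
  show ?thesis unfolding e funpow_add by (simp only: funpow.simps o_apply)
qed

lemma affine_mid:
  assumes "u \<in> {0..eps (Suc n)}"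
  shows "lft n + u * len n / eps n \<in> {lft n..mid n}"
proof -
  have "u * len n / eps n \<le> eps (Suc n) * len n / eps n"
    using assms len_pos[of n] eps_pos[of n] by (intro divide_right_mono mult_right_mono) auto
  also have "\<dots> = rad n / 3" using len_pos[of n] eps_pos[of n] by (simp add: field_simps)
  finally have "u * len n / eps n \<le> rad n / 3" .
  moreover have "0 \<le> u * len n / eps n" using assms len_pos[of n] eps_pos[of n] by simp
  ultimately show ?thesis unfolding lft_def mid_def atLeastAtMost_iff by linarith
qed

text \<open>In the induction step the first run carries \<open>u\<close> into
  \<open>[lft n, mid n]\<close>, and the remaining \<open>2 ^ n\<close> steps act there as the
  affine branch of \<open>ret n\<close>. A composition of affine maps results.\<close>

lemma gmap_pow_affine:
  assumes "u \<in> {0..eps n}"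
  shows "(gmap ^^ (2 ^ n - 1)) u = lft n + u * len n / eps n"
  using assms
proof (induction n arbitrary: u)
  case 0
  then show ?case by (simp add: lft_def len_def rad_0)
next
  case (Suc n)
  define w where "w = lft n + u * len n / eps n"
  have u: "u \<in> {0..eps n}" using Suc.prems eps_antimono[of n "Suc n"] by auto
  have w: "w \<in> {lft n..mid n}" using affine_mid[OF Suc.prems] by (simp add: w_def)
  have wn: "w \<in> nest n" using w order_facts[of n] order_facts(4)[of "Suc n"] by (auto simp: nest_def)
  have "(gmap ^^ (2 ^ Suc n - 1)) u = (gmap ^^ (2 ^ n - 1)) (gmap w)"
    using Suc.IH[OF u] by (simp only: pow_split w_def)
  also have "\<dots> = lft n + gmap w * len n / eps n"
    using Suc.IH gmap_nest[OF wn] by blast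
  also have "gmap w = piece n w"
    using w order_facts[of n] by (intro gmap_piece) auto
  also have "lft n + piece n w * len n / eps n = ret n w"
    using len_pos[of n] eps_pos[of n] by (simp add: piece_def)
  also have "ret n w = lft (Suc n) + 3 * len (Suc n) / rad n * (w - lft n)"
    using w by (simp add: ret_left)
  also have "\<dots> = lft (Suc n) + u * len (Suc n) / eps (Suc n)"
    by (simp add: w_def field_simps)
  finally show ?case .
qed

lemma gmap_return_eq:
  assumes "lft n \<le> x" "x \<le> lft (Suc n)"
  shows "(gmap ^^ (2 ^ n)) x = ret n x"
proof -
  have x: "x \<in> nest n" using assms order_facts[of n] order_facts[of "Suc n"] by (auto simp: nest_def)
  have e: "(2::nat) ^ n = Suc (2 ^ n - 1)" by simp
  have "(gmap ^^ (2 ^ n)) x = (gmap ^^ (2 ^ n - 1)) (gmap x)"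
    by (subst e) (simp only: funpow_Suc_right o_apply)
  also have "\<dots> = lft n + piece n x * len n / eps n"
    using gmap_pow_affine[OF gmap_nest[OF x]] gmap_piece[OF assms] by simp
  also have "\<dots> = ret n x"
    using len_pos[of n] eps_pos[of n] by (simp add: piece_def)
  finally show ?thesis .
qed

lemma gmap_return_sym: "(gmap ^^ (2 ^ n)) (3 - x) = (gmap ^^ (2 ^ n)) x"
proof -
  have e: "(2::nat) ^ n = Suc (2 ^ n - 1)" by simp
  show ?thesis by (subst (1 2) e) (simp only: funpow_Suc_right o_apply gmap_sym)
qed

lemma gmap_return_conv: "(gmap ^^ (2 ^ n - 1)) (gmap x) = (gmap ^^ (2 ^ n)) x"
proof -
  have e: "(2::nat) ^ n = Suc (2 ^ n - 1)" by simp
  show ?thesis by (subst (2) e) (simp only: funpow_Suc_right o_apply)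
qed

text \<open>This is period doubling: half of the period of \<open>nest (Suc n)\<close> moves it to
  the left of itself inside \<open>nest n\<close>.\<close>

lemma gmap_return_nest_Suc:
  assumes "x \<in> nest (Suc n)"
  shows "(gmap ^^ (2 ^ n)) x \<in> {lft n..mid n}"
proof -
  have "gmap x \<in> {0..eps (Suc n)}" using gmap_nest[OF assms] .
  moreover from this have "gmap x \<in> {0..eps n}" using eps_antimono[of n "Suc n"] by auto
  ultimately show ?thesis
    using affine_mid gmap_pow_affine by (simp only: gmap_return_conv[symmetric])
qed

lemma gmap_return_nest:
  assumes "x \<in> nest n"
  shows "(gmap ^^ (2 ^ n)) x \<in> {lft n..rgt (Suc n)}"
proof -
  have left: "(gmap ^^ (2 ^ n)) y \<in> {lft n..rgt (Suc n)}" if "lft n \<le> y" "y \<le> lft (Suc n)" for y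
    using ret_bounds[OF that] gmap_return_eq[OF that] by simp
  consider "x \<in> nest (Suc n)" | "lft n \<le> x" "x \<le> lft (Suc n)"
    | "lft n \<le> 3 - x" "3 - x \<le> lft (Suc n)"
    using assms order_facts(8)[of n] order_facts(8)[of "Suc n"]
    unfolding nest_def atLeastAtMost_iff by linarith
  then show ?thesis
  proof cases
    case 1
    then show ?thesis
      using gmap_return_nest_Suc[OF 1] order_facts(3)[of n] order_facts(4,5)[of "Suc n"] by auto
  next
    case 2
    then show ?thesis by (rule left)
  next
    case 3
    then show ?thesis using left[OF 3] gmap_return_sym[of n x] by simp
  qed
qed

lemma gmap_return_mem_nest: "x \<in> nest n \<Longrightarrow> (gmap ^^ (2 ^ n)) x \<in> nest n"
  using gmap_return_nest[of x n] order_facts(6)[of n] by (auto simp: nest_def)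

lemma mid_not_nest_Suc: "x \<in> {lft n..mid n} \<Longrightarrow> x \<in> nest n - nest (Suc n)"
  using order_facts(2,3,4,5)[of n] order_facts(4)[of "Suc n"] by (auto simp: nest_def)

text \<open>By induction the only time left to exclude for \<open>nest (Suc n)\<close> is
  \<open>2 ^ n\<close>, when the orbit is in \<open>[lft n, mid n]\<close>.\<close>

lemma nest_no_early_return:
  "x \<in> nest n \<Longrightarrow> 0 < k \<Longrightarrow> k < 2 ^ n \<Longrightarrow> (gmap ^^ k) x \<notin> nest n"
proof (induction n arbitrary: x k)
  case (Suc n)
  have sub: "nest (Suc n) \<subseteq> nest n" by (rule nest_antimono) simp
  consider "k < 2 ^ n" | "k = 2 ^ n" | j where "k = j + 2 ^ n" "0 < j" "j < 2 ^ n"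
  proof -
    assume a: "k < 2 ^ n \<Longrightarrow> thesis" "k = 2 ^ n \<Longrightarrow> thesis"
      "\<And>j. k = j + 2 ^ n \<Longrightarrow> 0 < j \<Longrightarrow> j < 2 ^ n \<Longrightarrow> thesis"
    show thesis using a(1,2) a(3)[of "k - 2 ^ n"] Suc.prems(3) by fastforce
  qed
  then show ?case
  proof cases
    case 1
    then show ?thesis using Suc.IH[of x k] Suc.prems sub by blast
  next
    case 2
    then show ?thesis using gmap_return_nest_Suc[OF Suc.prems(1)] mid_not_nest_Suc by blast
  next
    case 3
    then have "(gmap ^^ k) x = (gmap ^^ j) ((gmap ^^ (2 ^ n)) x)" by (simp add: funpow_add)
    moreover have "(gmap ^^ (2 ^ n)) x \<in> nest n"
      using gmap_return_mem_nest Suc.prems(1) sub by blast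
    ultimately show ?thesis using Suc.IH 3 sub by (metis subsetD)
  qed
qed simp

text \<open>This is the source of the asymmetry: besides \<open>nest (Suc n)\<close> itself, its
  orbit visits \<open>nest n\<close> only to the left of the plateau.\<close>

lemma nest_Suc_visits_nest:
  assumes "x \<in> nest (Suc n)" "k < 2 ^ Suc n" "(gmap ^^ k) x \<in> nest n"
  shows "(gmap ^^ k) x \<in> {lft n..mid n} \<union> nest (Suc n)"
proof -
  have sub: "nest (Suc n) \<subseteq> nest n" by (rule nest_antimono) simp
  consider "k = 0" | "0 < k" "k < 2 ^ n" | j where "k = j + 2 ^ n" "j < 2 ^ n"
  proof -
    assume a: "k = 0 \<Longrightarrow> thesis" "0 < k \<Longrightarrow> k < 2 ^ n \<Longrightarrow> thesis"
      "\<And>j. k = j + 2 ^ n \<Longrightarrow> j < 2 ^ n \<Longrightarrow> thesis"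
    show thesis using a(1,2) a(3)[of "k - 2 ^ n"] assms(2) by fastforce
  qed
  then show ?thesis
  proof cases
    case 1
    then show ?thesis using assms by simp
  next
    case 2
    then show ?thesis using nest_no_early_return[of x n k] assms sub by blast
  next
    case 3
    define w where "w = (gmap ^^ (2 ^ n)) x"
    have w: "w \<in> {lft n..mid n}" using gmap_return_nest_Suc[OF assms(1)] by (simp add: w_def)
    have k: "(gmap ^^ k) x = (gmap ^^ j) w" by (simp add: 3 funpow_add w_def)
    have "j = 0"
      using nest_no_early_return[of w n j] w mid_not_nest_Suc[OF w] 3 assms(3) k by auto
    then show ?thesis using k w by simp
  qed
qed

section \<open>Li-Yorke chaos\<close>

text \<open>The case \<open>False\<close> is the mirror image of the case \<open>True\<close>, as
  \<open>rgt n = 3 - lft n\<close>.\<close>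

definition side :: "nat \<Rightarrow> bool \<Rightarrow> real set" where
  "side n b = (if b then {lft n..mid n} else {3 - mid n..rgt n})"

lemma side_subset_nest: "side n b \<subseteq> nest n"
  using order_facts(2,3,4,5,8)[of n] order_facts(4)[of "Suc n"] by (auto simp: side_def nest_def)

text \<open>The left side covers \<open>nest (Suc n)\<close> by the intermediate value theorem, and
  the right side by symmetry.\<close>

lemma gmap_return_side_surj:
  assumes "w \<in> nest (Suc n)"
  shows "\<exists>v\<in>side n b. (gmap ^^ (2 ^ n)) v = w"
proof -
  have "w \<in> {lft (Suc n)..rgt (Suc n)}" using assms by (simp add: nest_def)
  moreover have "continuous_on {lft n..mid n} (gmap ^^ (2 ^ n))" by (rule continuous_on_gmap_pow)
  moreover have "(gmap ^^ (2 ^ n)) (lft n) = lft (Suc n)" "(gmap ^^ (2 ^ n)) (mid n) = rgt (Suc n)"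
    using order_facts(2,3)[of n] by (simp_all add: gmap_return_eq ret_lft ret_mid)
  ultimately obtain v where v: "v \<in> {lft n..mid n}" "(gmap ^^ (2 ^ n)) v = w"
    using IVT'[of "gmap ^^ (2 ^ n)" "lft n" w "mid n"] order_facts(2)[of n] by auto
  then have "3 - v \<in> side n False" "v \<in> side n True"
    using order_facts(8)[of n] by (auto simp: side_def)
  moreover have "(gmap ^^ (2 ^ n)) (3 - v) = w" using v by (simp add: gmap_return_sym)
  ultimately show ?thesis using v by (cases b) auto
qed

text \<open>The point is found backwards: pull \<open>w\<close> back to a point of the prescribed
  side at level \<open>N\<close>, and use that point as the next target.\<close>

lemma ex_finite_itinerary:
  assumes "w \<in> nest N"
  shows "\<exists>x\<in>{0..3}. (\<forall>k<N. (gmap ^^ (2 ^ k - 1)) x \<in> side k (s k)) \<and> (gmap ^^ (2 ^ N - 1)) x = w"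
  using assms
proof (induction N arbitrary: w)
  case 0
  then show ?case by (auto simp: nest_def lft_def rgt_def rad_0)
next
  case (Suc N)
  obtain v where v: "v \<in> side N (s N)" "(gmap ^^ (2 ^ N)) v = w"
    using gmap_return_side_surj[OF Suc.prems] by blast
  obtain x where x: "x \<in> {0..3}" "\<And>k. k < N \<Longrightarrow> (gmap ^^ (2 ^ k - 1)) x \<in> side k (s k)"
    "(gmap ^^ (2 ^ N - 1)) x = v"
    using Suc.IH[of v] v side_subset_nest by blast
  have "(gmap ^^ (2 ^ Suc N - 1)) x = w"
    using v(2) by (simp only: pow_split x(3) gmap_return_conv)
  then show ?case using x v by (intro bexI[of _ x]) (auto simp: less_Suc_eq)
qed

text \<open>The points with a given finite itinerary form decreasing nonempty compact sets.\<close>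

lemma ex_itinerary: "\<exists>x\<in>{0..3}. \<forall>k. (gmap ^^ (2 ^ k - 1)) x \<in> side k (s k)"
proof -
  define C where "C N = {0..3} \<inter> (\<Inter>k\<in>{..<N}. (gmap ^^ (2 ^ k - 1)) -` side k (s k))" for N
  have "\<Inter> (range C) \<noteq> {}"
  proof (rule compact_nest)
    show "compact (C N)" for N
      unfolding C_def
      by (intro compact_Int_closed closed_INT closed_vimage ballI continuous_on_gmap_pow)
         (auto simp: side_def)
    show "C N \<noteq> {}" for N
      using ex_finite_itinerary[of "lft N" N s] order_facts[of N] by (fastforce simp: C_def nest_def)
    show "C n \<subseteq> C m" if "m \<le> n" for m n
      using that by (auto simp: C_def)
  qed
  then obtain x where "x \<in> C N" for N by blast
  then have "x \<in> {0..3}" "(gmap ^^ (2 ^ k - 1)) x \<in> side k (s k)" for k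
    unfolding C_def by blast+
  then show ?thesis by blast
qed

lemma gmap_image: "gmap ` {0..3} \<subseteq> {0..3}"
  using gmap_nest[of _ 0] by (fastforce simp: nest_def lft_def rgt_def rad_0)

lemma dist_side:
  assumes "x \<in> side n b" "y \<in> side n c" "b \<noteq> c"
  shows "dist x y \<ge> 1"
  using assms order_facts(3)[of n] order_facts(4)[of "Suc n"]
  by (auto simp: side_def dist_real_def split: if_splits)

lemma gmap_li_yorke: "li_yorke_chaotic_on {0..3} gmap"
proof -
  \<comment> \<open>Each \<open>i\<close> is tested at all positions
    \<open>prod_encode (i, N)\<close>, so the itineraries of distinct sets differ infinitely
    often.\<close>
  define s where "s A n = (fst (prod_decode n) \<in> A)" for A :: "nat set" and n
  define X where "X A = (SOME x. x \<in> {0..3} \<and> (\<forall>k. (gmap ^^ (2 ^ k - 1)) x \<in> side k (s A k)))" for A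
  have "X A \<in> {0..3} \<and> (\<forall>k. (gmap ^^ (2 ^ k - 1)) (X A) \<in> side k (s A k))" for A
    unfolding X_def by (rule someI_ex) (use ex_itinerary[of "s A"] in blast)
  then have X: "\<And>A. X A \<in> {0..3}" "\<And>A k. (gmap ^^ (2 ^ k - 1)) (X A) \<in> side k (s A k)"
    by blast+
  have far: "\<exists>n\<ge>N. dist ((gmap ^^ n) (X A)) ((gmap ^^ n) (X B)) \<ge> 1" if AB: "A \<noteq> B" for A B N
  proof -
    obtain i where i: "(i \<in> A) \<noteq> (i \<in> B)" using AB by blast
    define k where "k = prod_encode (i, N)"
    have "s A k \<noteq> s B k" using i by (simp add: s_def k_def)
    then have "dist ((gmap ^^ (2 ^ k - 1)) (X A)) ((gmap ^^ (2 ^ k - 1)) (X B)) \<ge> 1"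
      using dist_side X(2) by blast
    moreover have "N \<le> 2 ^ k - 1"
      using le_prod_encode_2[of N i] less_exp[of k] unfolding k_def by linarith
    ultimately show ?thesis by blast
  qed
  have near: "\<exists>n\<ge>N. dist ((gmap ^^ n) (X A)) ((gmap ^^ n) (X B)) < e" if e: "e > 0" for A B N e
  proof -
    obtain M where M: "\<And>k. k \<ge> M \<Longrightarrow> eps k < e"
      using order_tendstoD(2)[OF eps_tendsto e] by (auto simp: eventually_sequentially)
    define k where "k = max M N"
    \<comment> \<open>At time \<open>2 ^ k - 1\<close> every chosen point is in
      \<open>nest k\<close>, on whichever side; one more step contracts it into
      \<open>[0, eps k]\<close>.\<close>
    have "(gmap ^^ (2 ^ k)) (X C) \<in> {0..eps k}" for C
    proof -
      have k: "(2::nat) ^ k = Suc (2 ^ k - 1)" by simp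
      show ?thesis
        by (subst k) (simp only: funpow.simps o_apply gmap_nest[OF subsetD[OF side_subset_nest X(2)]])
    qed
    from this[of A] this[of B]
    have "dist ((gmap ^^ (2 ^ k)) (X A)) ((gmap ^^ (2 ^ k)) (X B)) \<le> eps k"
      by (auto simp: dist_real_def)
    also have "eps k < e" using M by (simp add: k_def)
    finally have "dist ((gmap ^^ (2 ^ k)) (X A)) ((gmap ^^ (2 ^ k)) (X B)) < e" .
    moreover have "N \<le> k" by (simp add: k_def)
    then have "N \<le> 2 ^ k" by (rule order_trans[OF _ less_imp_le[OF less_exp]])
    ultimately show ?thesis by (intro exI[of _ "2 ^ k"] conjI)
  qed
  have "inj X"
  proof (rule injI, rule ccontr)
    fix A B assume "X A = X B" "A \<noteq> B"
    then show False using far[of A B 0] by simp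
  qed
  have "uncountable (range X)"
  proof
    assume "countable (range X)"
    then have "countable (UNIV :: nat set set)"
      using countable_image_inj_eq[OF \<open>inj X\<close>] by simp
    then have "range (from_nat_into (UNIV :: nat set set)) = Pow UNIV"
      by (simp add: range_from_nat_into)
    then show False using Cantors_theorem by blast
  qed
  moreover have "limsup (\<lambda>n. ereal (dist ((gmap ^^ n) x) ((gmap ^^ n) y))) > 0 \<and>
           liminf (\<lambda>n. ereal (dist ((gmap ^^ n) x) ((gmap ^^ n) y))) = 0"
    if xy: "x \<in> range X" "y \<in> range X" "x \<noteq> y" for x y
  proof -
    obtain A B where AB: "x = X A" "y = X B" "A \<noteq> B" using xy by auto
    define u where "u = (\<lambda>n. ereal (dist ((gmap ^^ n) x) ((gmap ^^ n) y)))"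
    have "\<not> limsup u < 1"
    proof
      assume "limsup u < 1"
      then have "eventually (\<lambda>n. u n < 1) sequentially" by (rule Limsup_lessD)
      then obtain N where "\<And>n. n \<ge> N \<Longrightarrow> u n < 1" unfolding eventually_sequentially by blast
      moreover obtain n where "n \<ge> N" "1 \<le> dist ((gmap ^^ n) x) ((gmap ^^ n) y)"
        using far[OF AB(3), of N] unfolding AB by blast
      ultimately show False by (fastforce simp: u_def one_ereal_def)
    qed
    then have "1 \<le> limsup u" by (simp only: not_less)
    moreover have "(0::ereal) < 1" by simp
    ultimately have "limsup u > 0" by (rule less_le_trans[rotated])
    moreover have "liminf u = 0"
    proof (rule antisym)
      show "liminf u \<le> 0"
      proof (rule ccontr)
        assume "\<not> liminf u \<le> 0"
        then obtain e where e: "0 < ereal e" "ereal e < liminf u"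
          using ereal_dense2[of 0 "liminf u"] by (auto simp: not_le)
        from e(2) have "eventually (\<lambda>n. ereal e < u n) sequentially" by (rule less_LiminfD)
        then obtain N where "\<And>n. n \<ge> N \<Longrightarrow> ereal e < u n" unfolding eventually_sequentially by blast
        moreover obtain n where "n \<ge> N" "dist ((gmap ^^ n) x) ((gmap ^^ n) y) < e"
          using near[of e N A B] e(1) unfolding AB by auto
        ultimately show False by (fastforce simp: u_def)
      qed
      show "0 \<le> liminf u" by (rule Liminf_bounded) (auto simp: u_def)
    qed
    ultimately show ?thesis by (simp add: u_def)
  qed
  ultimately show ?thesis
    unfolding li_yorke_chaotic_on_def
    by (intro exI[of _ "range X"] conjI ballI impI image_subsetI X(1)) simp_all
qed

section \<open>Absence of Wiggins chaos\<close>

text \<open>For times in the first half, the induction hypothesis is followed by the affine branch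
  of \<open>ret n\<close>, whose slope is at least 1; for the second half, the hypothesis is applied
  after time \<open>2 ^ n\<close>.\<close>

lemma gmap_pow_dist_le:
  assumes "u \<in> {0..eps n}" "v \<in> {0..eps n}" "k < 2 ^ n"
  shows "\<bar>(gmap ^^ k) u - (gmap ^^ k) v\<bar> \<le> \<bar>(gmap ^^ (2 ^ n - 1)) u - (gmap ^^ (2 ^ n - 1)) v\<bar>"
  using assms
proof (induction n arbitrary: u v k)
  case (Suc n)
  define a b where "a = (gmap ^^ (2 ^ n - 1)) u" and "b = (gmap ^^ (2 ^ n - 1)) v"
  have uv: "u \<in> {0..eps n}" "v \<in> {0..eps n}"
    using Suc.prems eps_antimono[of n "Suc n"] by auto
  have ab: "a \<in> {lft n..mid n}" "b \<in> {lft n..mid n}"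
    using affine_mid Suc.prems uv by (simp_all only: a_def b_def gmap_pow_affine)
  have g: "gmap a \<in> {0..eps n}" "gmap b \<in> {0..eps n}"
    using ab mid_not_nest_Suc gmap_nest by blast+
  have last: "(gmap ^^ (2 ^ Suc n - 1)) u = (gmap ^^ (2 ^ n - 1)) (gmap a)"
    "(gmap ^^ (2 ^ Suc n - 1)) v = (gmap ^^ (2 ^ n - 1)) (gmap b)"
    by (simp_all only: pow_split a_def b_def)
  consider "k < 2 ^ n" | j where "k = j + 2 ^ n" "j < 2 ^ n"
  proof -
    assume a: "k < 2 ^ n \<Longrightarrow> thesis" "\<And>j. k = j + 2 ^ n \<Longrightarrow> j < 2 ^ n \<Longrightarrow> thesis"
    show thesis using a(1) a(2)[of "k - 2 ^ n"] Suc.prems(3) by fastforce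
  qed
  then show ?case
  proof cases
    case 1
    have "\<bar>(gmap ^^ k) u - (gmap ^^ k) v\<bar> \<le> 1 * \<bar>a - b\<bar>"
      using Suc.IH[OF uv 1] by (simp add: a_def b_def)
    also have "\<dots> \<le> 3 * len (Suc n) / rad n * \<bar>a - b\<bar>"
      using rad_pos[of n] rad_le_1[of n] rad_pos[of "Suc n"]
      by (intro mult_right_mono) (auto simp: len_def field_simps)
    also have "\<dots> = \<bar>ret n a - ret n b\<bar>"
    proof -
      have "ret n a - ret n b = 3 * len (Suc n) / rad n * (a - b)"
        using ab by (simp add: ret_left algebra_simps flip: diff_divide_distrib)
      then show ?thesis using len_pos[of "Suc n"] rad_pos[of n] by (simp add: abs_mult)
    qed
    also have "\<dots> = \<bar>(gmap ^^ (2 ^ Suc n - 1)) u - (gmap ^^ (2 ^ Suc n - 1)) v\<bar>"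
      using ab order_facts(3)[of n] by (simp only: last gmap_return_conv) (simp add: gmap_return_eq)
    finally show ?thesis .
  next
    case 2
    have e: "(2::nat) ^ n = Suc (2 ^ n - 1)" by simp
    have "(gmap ^^ (2 ^ n)) u = gmap a" "(gmap ^^ (2 ^ n)) v = gmap b"
      unfolding a_def b_def by (subst e, simp only: funpow.simps o_apply)+
    then have "(gmap ^^ k) u = (gmap ^^ j) (gmap a)" "(gmap ^^ k) v = (gmap ^^ j) (gmap b)"
      by (simp_all add: 2 funpow_add)
    then show ?thesis using Suc.IH[OF g 2(2)] by (simp only: last)
  qed
qed simp

section \<open>Orbits that enter the interior of the next interval\<close>

definition enters :: "nat \<Rightarrow> real \<Rightarrow> bool" where
  "enters n x \<longleftrightarrow> (\<exists>j. (gmap ^^ j) x \<in> {lft (Suc n)<..<rgt (Suc n)})"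

lemma enters_pow: "enters n ((gmap ^^ k) x) \<Longrightarrow> enters n x"
  unfolding enters_def by (metis funpow_add o_apply)

lemma enters_sym: "enters n (3 - x) \<longleftrightarrow> enters n x"
proof -
  have *: "enters n y" if y: "enters n (3 - y)" for y
  proof -
    obtain j where j: "(gmap ^^ j) (3 - y) \<in> {lft (Suc n)<..<rgt (Suc n)}"
      using y by (auto simp: enters_def)
    show ?thesis
    proof (cases j)
      case 0
      then have "(gmap ^^ 0) y \<in> {lft (Suc n)<..<rgt (Suc n)}"
        using j order_facts(8)[of "Suc n"] by auto
      then show ?thesis unfolding enters_def by blast
    next
      case (Suc i)
      then have "(gmap ^^ j) (3 - y) = (gmap ^^ j) y"
        by (simp add: funpow_Suc_right gmap_sym del: funpow.simps)
      then show ?thesis using j unfolding enters_def by auto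
    qed
  qed
  show ?thesis using *[of x] *[of "3 - x"] by auto
qed

text \<open>The interior of the left branch is mapped into the target at once. The endpoints follow
  in a chain: \<open>lft (Suc n)\<close> goes to \<open>low n\<close> in that interior,
  \<open>mid n\<close> to the mirror image of \<open>lft (Suc n)\<close>, and \<open>lft n\<close>
  to \<open>lft (Suc n)\<close>.\<close>

lemma enters_outside_gap:
  assumes "lft n \<le> x" "x \<le> 3 / 2" "x \<notin> {mid n<..<lft (Suc n)}"
  shows "enters n x"
proof -
  have int: "enters n x" if "lft n < x" "x < mid n" for x
  proof -
    have "ret n x \<in> {lft (Suc n)<..<rgt (Suc n)}"
      using ret_bounds_left(3,4)[of n x] that by auto
    moreover have "(gmap ^^ (2 ^ n)) x = ret n x"
      using that order_facts(3)[of n] by (intro gmap_return_eq) auto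
    ultimately show ?thesis unfolding enters_def by metis
  qed
  have "(gmap ^^ (2 ^ n)) (lft (Suc n)) = low n"
    using gmap_return_eq[of n "lft (Suc n)"] order_facts(2,3)[of n] ret_lft_Suc by simp
  then have p: "enters n (lft (Suc n))"
    using int[of "low n"] low_bounds[of n] enters_pow by metis
  have "(gmap ^^ (2 ^ n)) (mid n) = 3 - lft (Suc n)"
    using gmap_return_eq[of n "mid n"] order_facts(2,3)[of n] ret_mid order_facts(8)[of "Suc n"] by simp
  then have m: "enters n (mid n)" using enters_sym p enters_pow by metis
  have "(gmap ^^ (2 ^ n)) (lft n) = lft (Suc n)"
    using gmap_return_eq[of n "lft n"] order_facts(2,3)[of n] ret_lft by simp
  then have l: "enters n (lft n)" using p enters_pow by metis
  consider "x = lft n" | "lft n < x" "x < mid n" | "x = mid n" | "x = lft (Suc n)" | "lft (Suc n) < x"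
    using assms by fastforce
  then show ?thesis
  proof cases
    case 5
    then have "(gmap ^^ 0) x \<in> {lft (Suc n)<..<rgt (Suc n)}"
      using assms(2) order_facts(5)[of "Suc n"] by simp
    then show ?thesis unfolding enters_def by blast
  qed (use int p m l in auto)
qed

lemma not_enters_return:
  assumes "x \<in> {mid n<..<lft (Suc n)}" "\<not> enters n x"
  shows "(gmap ^^ (2 ^ n)) x \<in> {mid n<..<lft (Suc n)}" "\<not> enters n ((gmap ^^ (2 ^ n)) x)"
    "(gmap ^^ (2 ^ n)) x = rgt (Suc n) - steep n * (x - mid n)"
proof -
  define y where "y = (gmap ^^ (2 ^ n)) x"
  have x: "lft n \<le> x" "x \<le> lft (Suc n)" "mid n \<le> x" using assms(1) order_facts(2)[of n] by auto
  have y: "y = ret n x" using x gmap_return_eq by (simp add: y_def)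
  then have yb: "lft n \<le> y" "y \<le> rgt (Suc n)" using ret_bounds x by auto
  show ne: "\<not> enters n ((gmap ^^ (2 ^ n)) x)" using assms(2) enters_pow by blast
  have "y \<in> {mid n<..<lft (Suc n)}"
  proof (cases "y \<le> 3 / 2")
    case True
    then show ?thesis using enters_outside_gap yb ne y_def by blast
  next
    case False
    \<comment> \<open>The mirror image of the gap lies beyond \<open>rgt (Suc n)\<close>, which
      bounds \<open>ret n\<close>; so this case is contradictory.\<close>
    have "3 - y \<in> {mid n<..<lft (Suc n)}"
    proof (rule ccontr)
      assume "3 - y \<notin> {mid n<..<lft (Suc n)}"
      then have "enters n (3 - y)"
        using False yb order_facts(8)[of "Suc n"] order_facts(2,3)[of n]
        by (intro enters_outside_gap) auto
      then show False using ne enters_sym y_def by blast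
    qed
    then show ?thesis using yb order_facts(8)[of "Suc n"] by auto
  qed
  then show "(gmap ^^ (2 ^ n)) x \<in> {mid n<..<lft (Suc n)}" by (simp add: y_def)
  show "(gmap ^^ (2 ^ n)) x = rgt (Suc n) - steep n * (x - mid n)"
    using y ret_gap[OF x(3)] by (simp add: y_def)
qed

text \<open>Both orbits under the return map would stay in the gap forever, while their distance at
  least triples at each return.\<close>

lemma not_enters_gap_unique:
  assumes "x \<in> {mid n<..<lft (Suc n)}" "\<not> enters n x"
    and "y \<in> {mid n<..<lft (Suc n)}" "\<not> enters n y"
  shows "x = y"
proof (rule ccontr)
  assume "x \<noteq> y"
  let ?F = "gmap ^^ (2 ^ n)"
  have *: "(?F ^^ k) z \<in> {mid n<..<lft (Suc n)} \<and> \<not> enters n ((?F ^^ k) z)"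
    if "z \<in> {mid n<..<lft (Suc n)}" "\<not> enters n z" for k z
    by (induction k) (use that not_enters_return in auto)
  have exp: "3 ^ k * \<bar>x - y\<bar> \<le> \<bar>(?F ^^ k) x - (?F ^^ k) y\<bar>" for k
  proof (induction k)
    case (Suc k)
    let ?a = "(?F ^^ k) x" and ?b = "(?F ^^ k) y"
    have "?F ?a - ?F ?b = - (steep n * (?a - ?b))"
      using not_enters_return(3)[of ?a n] not_enters_return(3)[of ?b n]
        *[OF assms(1,2), of k] *[OF assms(3,4), of k]
      by (simp add: algebra_simps)
    then have "\<bar>?F ?a - ?F ?b\<bar> = steep n * \<bar>?a - ?b\<bar>"
      using steep_ge[of n] by (simp add: abs_mult)
    also have "\<dots> \<ge> 3 * (3 ^ k * \<bar>x - y\<bar>)"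
      using Suc steep_ge[of n] by (intro mult_mono) auto
    finally show ?case by simp
  qed simp
  have "\<bar>x - y\<bar> > 0" using \<open>x \<noteq> y\<close> by simp
  obtain k where "1 / \<bar>x - y\<bar> < 3 ^ k" using real_arch_pow[of 3 "1 / \<bar>x - y\<bar>"] by auto
  then have "1 < 3 ^ k * \<bar>x - y\<bar>" using \<open>\<bar>x - y\<bar> > 0\<close> by (simp add: field_simps)
  moreover have "\<bar>(?F ^^ k) x - (?F ^^ k) y\<bar> < 1"
    using *[OF assms(1,2), of k] *[OF assms(3,4), of k] order_facts(1,2)[of n] order_facts(4)[of "Suc n"]
    by auto
  ultimately show False using exp[of k] by linarith
qed

text \<open>
  The exceptional points are the repelling fixed point of \<open>ret n\<close> in the gap and its mirror image;
  comparing two points avoids computing it.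
\<close>

lemma not_enters_unique:
  assumes "x \<in> nest n" "\<not> enters n x" "y \<in> nest n" "\<not> enters n y"
  shows "y = x \<or> y = 3 - x"
proof -
  have *: "min z (3 - z) \<in> {mid n<..<lft (Suc n)} \<and> \<not> enters n (min z (3 - z))"
    if "z \<in> nest n" "\<not> enters n z" for z
  proof -
    have "\<not> enters n (min z (3 - z))" using that enters_sym by (simp add: min_def)
    moreover have "lft n \<le> min z (3 - z)" "min z (3 - z) \<le> 3 / 2"
      using that(1) order_facts(8)[of n] by (auto simp: nest_def min_def)
    ultimately show ?thesis using enters_outside_gap by blast
  qed
  have "min x (3 - x) = min y (3 - y)"
    using *[OF assms(1,2)] *[OF assms(3,4)] not_enters_gap_unique by blast
  then show ?thesis by (auto simp: min_def split: if_splits)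
qed

section \<open>Consequences of sensitivity and transitivity\<close>

lemma sensitive_map_on_imp_infinite_nhd:
  assumes "sensitive_map_on Y T" "open W" "W \<inter> Y \<noteq> {}"
  shows "infinite (W \<inter> Y)"
proof
  assume fin: "finite (W \<inter> Y)"
  obtain y where y: "y \<in> W" "y \<in> Y" using assms by blast
  have "open (W - (W \<inter> Y - {y}))"
    using assms(2) fin by (intro open_Diff finite_imp_closed) auto
  moreover have "{y} = Y \<inter> (W - (W \<inter> Y - {y}))" using y by auto
  ultimately have "openin (top_of_set Y) {y}" by (metis openin_open)
  \<comment> \<open>An isolated point has a neighbourhood containing no other point, so no orbit can
    separate from its own.\<close>
  then have nb: "neighbourhood_in Y y {y}" using y by (auto simp: neighbourhood_in_def)
  obtain d where d: "d > 0" "\<forall>x\<in>Y. \<forall>U. neighbourhood_in Y x U \<longrightarrow>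
        (\<exists>y\<in>U. \<exists>n. dist ((T ^^ n) x) ((T ^^ n) y) \<ge> d)"
    using assms(1) by (auto simp: sensitive_map_on_def)
  from d(2) y nb have "\<exists>z\<in>{y}. \<exists>n. dist ((T ^^ n) y) ((T ^^ n) z) \<ge> d" by blast
  then show False using d(1) by simp
qed

lemma transitive_map_on_visits:
  assumes "transitive_map_on Y T" "open U" "U \<inter> Y \<noteq> {}" "open V" "V \<inter> Y \<noteq> {}"
  shows "\<exists>n. \<exists>v\<in>V \<inter> Y. (T ^^ n) v \<in> U"
proof -
  have "openin (top_of_set Y) (U \<inter> Y)" "openin (top_of_set Y) (V \<inter> Y)"
    using openin_open_Int[OF assms(2), of Y] openin_open_Int[OF assms(4), of Y]
    by (simp_all add: Int_commute)
  then obtain n where "((T ^^ n) -` (U \<inter> Y) \<inter> Y) \<inter> (V \<inter> Y) \<noteq> {}"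
    using assms unfolding transitive_map_on_def by meson
  then show ?thesis by blast
qed

text \<open>Otherwise transitivity yields an orbit from \<open>W\<close> to the complement of
  \<open>A\<close>, although \<open>A\<close> is invariant.\<close>

lemma transitive_map_on_subset_invariant:
  assumes "transitive_map_on Y T" "closed A" "T ` A \<subseteq> A" "open W" "W \<subseteq> A" "W \<inter> Y \<noteq> {}"
  shows "Y \<subseteq> A"
proof (rule ccontr)
  assume "\<not> Y \<subseteq> A"
  then have "(- A) \<inter> Y \<noteq> {}" by blast
  then obtain n v where "v \<in> W" "(T ^^ n) v \<in> - A"
    using transitive_map_on_visits[OF assms(1), of "- A" W] assms by blast
  moreover have "(T ^^ n) v \<in> A" if "v \<in> A" for v
    by (induction n) (use that assms(3) in auto)
  ultimately show False using assms(5) by blast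
qed

definition cycle :: "nat \<Rightarrow> real set" where
  "cycle n = (\<Union>k<2 ^ n. (gmap ^^ k) ` nest n)"

lemma closed_cycle: "closed (cycle n)"
  unfolding cycle_def nest_def
  by (intro closed_UN ballI compact_imp_closed compact_continuous_image continuous_on_gmap_pow) auto

lemma nest_subset_cycle: "nest n \<subseteq> cycle n"
  by (force simp: cycle_def intro!: bexI[of _ "0::nat"])

lemma gmap_cycle: "gmap ` cycle n \<subseteq> cycle n"
proof
  fix y assume "y \<in> gmap ` cycle n"
  then obtain k x where kx: "k < 2 ^ n" "x \<in> nest n" "y = (gmap ^^ Suc k) x"
    by (auto simp: cycle_def)
  show "y \<in> cycle n"
  proof (cases "Suc k < 2 ^ n")
    case True
    then show ?thesis unfolding cycle_def using kx by blast
  next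
    case False
    then have "Suc k = 2 ^ n" using kx(1) by simp
    then show ?thesis using kx gmap_return_mem_nest[OF kx(2)] nest_subset_cycle by auto
  qed
qed

section \<open>Confinement of a transitive sensitive subsystem\<close>

context
  fixes Y :: "real set"
  assumes Y: "Y \<noteq> {}" "Y \<subseteq> {0..3}" "gmap ` Y \<subseteq> Y"
    and tr: "transitive_map_on Y gmap" and se: "sensitive_map_on Y gmap"
begin

lemma Y_pow: "y \<in> Y \<Longrightarrow> (gmap ^^ n) y \<in> Y"
  by (induction n) (use Y(3) in auto)

text \<open>At each level at most two points, mirror images of each other, fail to enter the next
  interval, whereas \<open>Y\<close> has infinitely many points in the current one.\<close>

lemma Y_meets_interior: "{lft n<..<rgt n} \<inter> Y \<noteq> {}"
proof (induction n)
  case 0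
  have "infinite Y" using sensitive_map_on_imp_infinite_nhd[OF se open_UNIV] Y(1) by simp
  then have "\<not> Y \<subseteq> {0, 3}" by (meson finite.emptyI finite.insertI finite_subset)
  then obtain y where y: "y \<in> Y" "y \<noteq> 0" "y \<noteq> 3" by blast
  then have "y \<in> {lft 0<..<rgt 0}" using Y(2) by (auto simp: lft_def rgt_def rad_0 subset_iff less_le)
  then show ?case using y(1) by blast
next
  case (Suc n)
  let ?W = "{lft n<..<rgt n}"
  have inf: "infinite (?W \<inter> Y)" using sensitive_map_on_imp_infinite_nhd[OF se _ Suc] by simp
  then obtain u where u: "u \<in> ?W \<inter> Y" using infinite_imp_nonempty by blast
  have "\<not> ?W \<inter> Y \<subseteq> {u, 3 - u}" using inf by (meson finite.emptyI finite.insertI finite_subset)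
  then obtain v where v: "v \<in> ?W \<inter> Y" "v \<noteq> u" "v \<noteq> 3 - u" by blast
  have "enters n u \<or> enters n v"
    using not_enters_unique[of u n v] u v by (auto simp: nest_def)
  then obtain y j where "y \<in> Y" "(gmap ^^ j) y \<in> {lft (Suc n)<..<rgt (Suc n)}"
    using u v by (auto simp: enters_def)
  then show ?case using Y_pow by blast
qed

lemma Y_subset_cycle: "Y \<subseteq> cycle n"
proof (rule transitive_map_on_subset_invariant[OF tr closed_cycle gmap_cycle])
  have "{lft n<..<rgt n} \<subseteq> nest n" by (auto simp: nest_def)
  then show "{lft n<..<rgt n} \<subseteq> cycle n" using nest_subset_cycle by blast
  show "{lft n<..<rgt n} \<inter> Y \<noteq> {}" by (rule Y_meets_interior)
qed simp

text \<open>A point of \<open>Y\<close> is the image, at some time below \<open>2 ^ Suc n\<close>,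
  of a point of \<open>nest (Suc n)\<close>, whose visits to \<open>nest n\<close> are
  known.\<close>

lemma Y_nest: "y \<in> Y \<Longrightarrow> y \<in> nest n \<Longrightarrow> y \<in> {lft n..mid n} \<union> nest (Suc n)"
  using Y_subset_cycle[of "Suc n"] nest_Suc_visits_nest[of _ n] by (auto simp: cycle_def)

text \<open>A point beyond 2 is never in \<open>[lft n, mid n]\<close>, so it would lie in every
  \<open>nest n\<close>.\<close>

lemma Y_le_2: assumes "y \<in> Y" shows "y \<le> 2"
proof (rule ccontr)
  assume y: "\<not> y \<le> 2"
  have nest: "y \<in> nest n" for n
  proof (induction n)
    case 0
    then show ?case using assms Y(2) by (auto simp: nest_def lft_def rgt_def rad_0)
  next
    case (Suc n)
    then show ?case
      using Y_nest[OF assms Suc] y order_facts(3)[of n] order_facts(4)[of "Suc n"] by auto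
  qed
  obtain N where "rad N < y - 2"
    using order_tendstoD(2)[OF rad_tendsto, of "y - 2"] y by (auto simp: eventually_sequentially)
  then show False using nest[of N] by (auto simp: nest_def rgt_def)
qed

lemma Y_plateau: "{1<..<2} \<inter> Y = {}"
proof (rule ccontr)
  assume ne: "{1<..<2} \<inter> Y \<noteq> {}"
  then have "infinite ({1<..<2} \<inter> Y)" using sensitive_map_on_imp_infinite_nhd[OF se] by simp
  from ne obtain u where u: "u \<in> {1<..<2} \<inter> Y" by blast
  have "\<not> {1<..<2} \<inter> Y \<subseteq> {u}"
    using \<open>infinite ({1<..<2} \<inter> Y)\<close> by (meson finite.emptyI finite.insertI finite_subset)
  then obtain v where v: "v \<in> {1<..<2} \<inter> Y" "v \<noteq> u" by blast
  define a b where "a = min u v" and "b = max u v"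
  define c where "c = (a + b) / 2"
  \<comment> \<open>The point \<open>c\<close> separates two points of \<open>Y\<close>, so the
    transition below from its right to its left takes positive time.\<close>
  have ab: "a \<in> {1<..<c} \<inter> Y" "b \<in> {c<..<2} \<inter> Y" and c: "1 < c" "c < 2"
    using u v by (auto simp: a_def b_def c_def min_def max_def split: if_splits)
  have "{1<..<c} \<inter> Y \<noteq> {}" "{c<..<2} \<inter> Y \<noteq> {}" using ab by blast+
  then obtain n w where w: "w \<in> {c<..<2}" "(gmap ^^ n) w \<in> {1<..<c}"
    using transitive_map_on_visits[OF tr, of "{1<..<c}" "{c<..<2}"] open_greaterThanLessThan
    by blast
  then have "n > 0" by (cases n) auto
  \<comment> \<open>The level is taken equal to the transition time \<open>n\<close>: since
    \<open>n < 2 ^ n\<close>, the plateau cannot be revisited at that time.\<close>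
  have "{1..2} \<subseteq> nest n" using order_facts(4,5)[of n] by (auto simp: nest_def)
  moreover have "w \<in> {1..2}" "(gmap ^^ n) w \<in> {1..2}" using w c by auto
  ultimately show False
    using nest_no_early_return[OF _ \<open>n > 0\<close> less_exp] by blast
qed

text \<open>Only the point 2 could remain, and it would be isolated in \<open>Y\<close>.\<close>

lemma Y_le_1: assumes "y \<in> Y" shows "y \<le> 1"
proof (rule ccontr)
  assume y: "\<not> y \<le> 1"
  then have "y \<in> {1<..} \<inter> Y" using assms by auto
  then have "{1<..} \<inter> Y \<noteq> {}" by blast
  then have "infinite ({1<..} \<inter> Y)" using sensitive_map_on_imp_infinite_nhd[OF se] by simp
  moreover have "{1<..} \<inter> Y \<subseteq> {2}" using Y_le_2 Y_plateau by force
  ultimately show False by (meson finite.emptyI finite.insertI finite_subset)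
qed

text \<open>The part of \<open>Y\<close> in \<open>nest n\<close> lies in \<open>[lft n, 1]\<close>,
  of length \<open>rad n\<close>. Distances at times up to \<open>2 ^ n\<close> are bounded by the
  distance at the return, and later times reduce to earlier ones.\<close>

lemma Y_orbit_close:
  assumes "x \<in> Y" "x \<in> nest n" "y \<in> Y" "y \<in> nest n"
  shows "\<bar>(gmap ^^ k) x - (gmap ^^ k) y\<bar> \<le> rad n"
  using assms
proof (induction k arbitrary: x y rule: less_induct)
  case (less k)
  have close: "\<bar>a - b\<bar> \<le> rad n" if "a \<in> Y" "a \<in> nest n" "b \<in> Y" "b \<in> nest n" for a b
    using that Y_le_1[of a] Y_le_1[of b] by (auto simp: nest_def lft_def abs_if)
  have ret: "(gmap ^^ (2 ^ n)) a \<in> Y" "(gmap ^^ (2 ^ n)) a \<in> nest n" if "a \<in> Y" "a \<in> nest n" for a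
    using that Y_pow gmap_return_mem_nest by auto
  \<comment> \<open>The expansion estimate starts at \<open>gmap x\<close> and
    \<open>gmap y\<close>, hence the shift to \<open>j\<close> with
    \<open>k = Suc j\<close>.\<close>
  consider "k = 0" | j where "k = Suc j" "j < 2 ^ n" | "k \<ge> 2 ^ n"
  proof -
    assume a: "k = 0 \<Longrightarrow> thesis" "\<And>j. k = Suc j \<Longrightarrow> j < 2 ^ n \<Longrightarrow> thesis" "2 ^ n \<le> k \<Longrightarrow> thesis"
    show thesis
    proof (cases k)
      case (Suc j)
      show thesis by (cases "j < 2 ^ n") (use a(2)[OF Suc] a(3) Suc in auto)
    qed (use a(1) in simp)
  qed
  then show ?case
  proof cases
    case 1
    then show ?thesis using close less.prems by simp
  next
    case 2
    have "\<bar>(gmap ^^ j) (gmap x) - (gmap ^^ j) (gmap y)\<bar>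
        \<le> \<bar>(gmap ^^ (2 ^ n)) x - (gmap ^^ (2 ^ n)) y\<bar>"
      using gmap_pow_dist_le[OF gmap_nest gmap_nest 2(2)] less.prems
      by (simp only: gmap_return_conv)
    also have "\<dots> \<le> rad n" using close ret less.prems by blast
    finally show ?thesis by (simp add: 2 funpow_Suc_right del: funpow.simps)
  next
    case 3
    then obtain j where j: "k = j + 2 ^ n" using le_Suc_ex by (metis add.commute)
    then have "j < k" by simp
    then show ?thesis using less.IH[of j] ret less.prems by (simp add: j funpow_add)
  qed
qed

lemma transitive_sensitive_contradiction: False
proof -
  obtain d where d: "d > 0" "\<forall>x\<in>Y. \<forall>U. neighbourhood_in Y x U \<longrightarrow>
        (\<exists>y\<in>U. \<exists>n. dist ((gmap ^^ n) x) ((gmap ^^ n) y) \<ge> d)"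
    using se by (auto simp: sensitive_map_on_def)
  obtain N where N: "rad N < d"
    using order_tendstoD(2)[OF rad_tendsto d(1)] by (auto simp: eventually_sequentially)
  let ?U = "Y \<inter> {lft N<..<rgt N}"
  obtain x where x: "x \<in> ?U" using Y_meets_interior[of N] by blast
  have "neighbourhood_in Y x ?U"
    using x unfolding neighbourhood_in_def by (intro conjI exI[of _ ?U] openin_open_Int) auto
  then obtain y k where "y \<in> ?U" "dist ((gmap ^^ k) x) ((gmap ^^ k) y) \<ge> d"
    using d(2) x by blast
  then show False
    using Y_orbit_close[of x N y k] x N by (auto simp: nest_def dist_real_def)
qed

end

theorem theorem1p8:
  shows "\<exists>(a::real) (b::real) (g::real \<Rightarrow> real).
    a < b \<and> continuous_on {a..b} g \<and> g ` {a..b} \<subseteq> {a..b} \<and>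
    li_yorke_chaotic_on {a..b} g \<and> \<not> wiggins_chaotic_on {a..b} g"
proof (intro exI conjI)
  show "\<not> wiggins_chaotic_on {0..3} gmap"
  proof
    assume "wiggins_chaotic_on {0..3} gmap"
    then obtain Y where Y: "Y \<noteq> {}" "closedin (top_of_set {0..3}) Y" "gmap ` Y \<subseteq> Y"
      "transitive_map_on Y gmap" "sensitive_map_on Y gmap"
      unfolding wiggins_chaotic_on_def by blast
    show False
      by (rule transitive_sensitive_contradiction[OF Y(1) closedin_imp_subset[OF Y(2)] Y(3-5)])
  qed
  show "(0::real) < 3" by simp
  show "continuous_on {0..3} gmap" by (rule continuous_on_gmap)
  show "gmap ` {0..3} \<subseteq> {0..3}" by (rule gmap_image)
  show "li_yorke_chaotic_on {0..3} gmap" by (rule gmap_li_yorke)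
qed

end
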